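(* Let $n\ge 1$. The bijection $\psi:\mathcal{T}_n\to\mathcal{W}_n$ from standard Young tableaux of shape $(n,n)$ to webs on $2n$ points is an isomorphism of directed graphs from the tableau graph $\Gamma^{\mathcal{T}_n}$ to the web graph $\Gamma^{\mathcal{W}_n}$. In particular the directed graphs $\Gamma^{\mathcal{T}_n}$ and $\Gamma^{\mathcal{W}_n}$ are isomorphic.
   Context: $\mathcal{T}_n$ is the set of standard Young tableaux of shape $(n,n)$: fillings of a $2\times n$ grid with $1,\dots,2n$, each used once, increasing left to right in rows and top to bottom in columns. $s_i\in S_{2n}$ ($1\le i\le 2n-1$) is the transposition of $i$ and $i+1$, and $s_i\cdot T$ is the tableau obtained from $T$ by swapping the entries $i$ and $i+1$. Tableau graph $\Gamma^{\mathcal{T}_n}$: the directed graph with vertex set $\mathcal{T}_n$ and an edge $T\stackrel{s_i}{\longrightarrow}T'$ (labeled $s_i$) if and only if $s_i\cdot T=T'$ and $i$ is below $i+1$ in $T$ (i.e. $i$ is in the second row and $i+1$ in the first row of $T$). A web on $2n$ points is a noncrossing perfect matching of the vertices $1,\dots,2n$ on a horizontal axis, drawn with nonintersecting arcs above the axis; $(i,j)$ denotes an arc with endpoints $i<j$, and $\{i,j\}$ an arc whose endpoints are not necessarily listed in order. $\mathcal{W}_n$ is the set of webs on $2n$ points, and $V^{\mathcal{W}_n}$ is the complex vector space with basis $\mathcal{W}_n$. $S_{2n}$ acts linearly on $V^{\mathcal{W}_n}$ by: $s_i\cdot w=-w$ if $(i,i+1)$ is an arc of $w$; otherwise, if $w$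 contains the arcs $\{i,j\}$ and $\{i+1,k\}$, then $s_i\cdot w=w+w'$ where $w'$ is the web obtained from $w$ by replacing these two arcs by $(i,i+1)$ and $\{j,k\}$. Web graph $\Gamma^{\mathcal{W}_n}$: the directed graph with vertex set $\mathcal{W}_n$ and an edge $w\stackrel{s_i}{\longrightarrow}w'$ (labeled $s_i$) if and only if $s_i\cdot w=w+w'$ and $w$ contains unnested arcs $(j,i)$ and $(i+1,k)$ (so $j<i<i+1<k$). The bijection $\psi$: given $T\in\mathcal{T}_n$, process the entries of the bottom row of $T$ from left to right; connect each such entry's vertex by an arc to its nearest not-yet-matched vertex to the left. The resulting web is $\psi(T)$. It is known that $\psi$ is a bijection. *)

theory Defs
  imports
    Complex_Main
    "HOL-Combinatorics.Transposition"
    "HOL-Library.Poly_Mapping"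
    "Graph_Theory.Graph_Theory"
begin

section \<open>Standard Young tableaux of shape (n,n)\<close>

text \<open>A filling of the \<open>2 \<times> n\<close> grid is the pair (first row, second row), each row
  listed from left to right.\<close>

type_synonym tableau = "nat list \<times> nat list"

definition tableaux :: "nat \<Rightarrow> tableau set" where
  "tableaux n = {(top, bot).
     length top = n \<and> length bot = n \<and>
     distinct (top @ bot) \<and> set (top @ bot) = {1..2*n} \<and>
     sorted_wrt (<) top \<and> sorted_wrt (<) bot \<and>
     (\<forall>c<n. top ! c < bot ! c)}"

definition swap_entries :: "nat \<Rightarrow> tableau \<Rightarrow> tableau" where
  "swap_entries i T =
     (map (Transposition.transpose i (i+1)) (fst T), map (Transposition.transpose i (i+1)) (snd T))"


section \<open>Webs\<close>

text \<open>An arc with endpoints \<open>i < j\<close> is the ordered pair \<open>(i, j)\<close>; two arcs drawn above the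
  axis can be drawn disjointly iff their endpoints do not interleave.\<close>

type_synonym web = "(nat \<times> nat) set"

definition webs :: "nat \<Rightarrow> web set" where
  "webs n = {w.
     (\<forall>(i, j)\<in>w. 1 \<le> i \<and> i < j \<and> j \<le> 2*n) \<and>
     (\<forall>v\<in>{1..2*n}. \<exists>!e. e \<in> w \<and> (v = fst e \<or> v = snd e)) \<and>
     (\<forall>(i, j)\<in>w. \<forall>(k, l)\<in>w. \<not> (i < k \<and> k < j \<and> j < l))}"

text \<open>The arc \<open>{i, j}\<close> whose endpoints are not necessarily listed in order.\<close>

definition mk_arc :: "nat \<Rightarrow> nat \<Rightarrow> nat \<times> nat" where
  "mk_arc i j = (min i j, max i j)"

definition partner :: "web \<Rightarrow> nat \<Rightarrow> nat" where
  "partner w i = (THE j. mk_arc i j \<in> w)"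

text \<open>For \<open>{i, j}, {i+1, k} \<in> w\<close>, replace these two arcs by \<open>(i, i+1)\<close> and \<open>{j, k}\<close>.\<close>

definition reconnect :: "nat \<Rightarrow> web \<Rightarrow> web" where
  "reconnect i w =
     (let j = partner w i; k = partner w (i+1)
      in (w - {mk_arc i j, mk_arc (i+1) k}) \<union> {(i, i+1), mk_arc j k})"


section \<open>The action of the simple transpositions on the web space\<close>

text \<open>Formal complex linear combinations of webs. The space with basis \<open>webs n\<close> consists of the
  vectors \<open>v\<close> with \<open>keys v \<subseteq> webs n\<close>.\<close>

type_synonym web_vec = "web \<Rightarrow>\<^sub>0 complex"

definition web_basis :: "web \<Rightarrow> web_vec" where
  "web_basis w = Poly_Mapping.single w 1"

definition act_basis :: "nat \<Rightarrow> web \<Rightarrow> web_vec" where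
  "act_basis i w =
     (if (i, i+1) \<in> w then - web_basis w else web_basis w + web_basis (reconnect i w))"

text \<open>The linear extension of \<open>act_basis i\<close>; here \<open>Poly_Mapping.map ((*) c)\<close> is scalar
  multiplication by \<open>c\<close>.\<close>

definition web_act :: "nat \<Rightarrow> web_vec \<Rightarrow> web_vec" where
  "web_act i v =
     (\<Sum>w\<in>Poly_Mapping.keys v. Poly_Mapping.map ((*) (Poly_Mapping.lookup v w)) (act_basis i w))"

lemma web_act_basis: "web_act i (web_basis w) = act_basis i w"
  by (rule poly_mapping_eqI) (simp add: web_act_def web_basis_def Poly_Mapping.map.rep_eq when_def)


section \<open>The two graphs\<close>

text \<open>An arc \<open>(x, i, y)\<close> of either digraph is the edge from \<open>x\<close> to \<open>y\<close> labelled \<open>s\<^sub>i\<close>.\<close>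

definition tableau_graph :: "nat \<Rightarrow> (tableau, tableau \<times> nat \<times> tableau) pre_digraph" where
  "tableau_graph n = \<lparr>
     verts = tableaux n,
     arcs = {(T, i, T'). T \<in> tableaux n \<and> T' \<in> tableaux n \<and> i \<in> {1..2*n-1} \<and>
               swap_entries i T = T' \<and> i \<in> set (snd T) \<and> i+1 \<in> set (fst T)},
     tail = (\<lambda>(T, i, T'). T),
     head = (\<lambda>(T, i, T'). T') \<rparr>"

definition web_graph :: "nat \<Rightarrow> (web, web \<times> nat \<times> web) pre_digraph" where
  "web_graph n = \<lparr>
     verts = webs n,
     arcs = {(w, i, w'). w \<in> webs n \<and> w' \<in> webs n \<and> i \<in> {1..2*n-1} \<and>
               web_act i (web_basis w) = web_basis w + web_basis w' \<and>
               (\<exists>j k. (j, i) \<in> w \<and> (i+1, k) \<in> w)},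
     tail = (\<lambda>(w, i, w'). w),
     head = (\<lambda>(w, i, w'). w') \<rparr>"


section \<open>The bijection\<close>

definition match_left :: "nat \<Rightarrow> web \<Rightarrow> web" where
  "match_left b w = insert (Max {a. 1 \<le> a \<and> a < b \<and> a \<notin> fst ` w \<union> snd ` w}, b) w"

definition psi :: "tableau \<Rightarrow> web" where
  "psi T = fold match_left (snd T) {}"

text \<open>The map of labelled digraphs induced by \<open>psi\<close>: it sends an edge from \<open>T\<close> to \<open>T'\<close> labelled
  \<open>s\<^sub>i\<close> to the edge from \<open>psi T\<close> to \<open>psi T'\<close> with the same label. The fields \<open>iso_tail\<close> and
  \<open>iso_head\<close> are the tail and head maps of the target graph.\<close>

definition psi_iso ::
  "(tableau, tableau \<times> nat \<times> tableau, web, web \<times> nat \<times> web) digraph_isomorphism" where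
  "psi_iso = \<lparr>
     iso_verts = psi,
     iso_arcs = (\<lambda>(T, i, T'). (psi T, i, psi T')),
     iso_head = (\<lambda>(w, i, w'). w'),
     iso_tail = (\<lambda>(w, i, w'). w) \<rparr>"

end

theory Submission
  imports Defs
begin

text \<open>
  A web is determined by the set of its right endpoints: reading from left to right, each right
  endpoint is forced to close the nearest left endpoint that is still open (\<open>web_eqI\<close>).
  A tableau is likewise determined by the set of entries of its second row, and the column
  condition is the ballot condition that makes every closing step possible. Since \<open>psi\<close> sends
  the second row of a tableau to the set of right endpoints (\<open>psi_web\<close>), and the right endpoints
  of every web form the second row of a tableau (\<open>web_tableau\<close>), \<open>psi\<close> is a bijection.

  On the level of these sets the edges of the two graphs are the same. An edge labelled
  \<open>s\<^sub>i\<close> leaves a tableau when \<open>i\<close> is in the second row and \<open>i+1\<close> in the first, and leaves a web when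
  \<open>i\<close> is a right endpoint and \<open>i+1\<close> a left endpoint; that is what the two unnested arcs express.
  Swapping the entries and reconnecting the arcs both replace \<open>i\<close> by \<open>i+1\<close> in the determining set,
  so \<open>psi\<close> of the swapped tableau is the reconnected web (\<open>psi_swap_entries\<close>) without any
  computation of \<open>psi\<close>.
\<close>

section \<open>Webs and their endpoints\<close>

definition noncrossing :: "web \<Rightarrow> bool" where
  "noncrossing w \<longleftrightarrow> (\<forall>(i, j)\<in>w. \<forall>(k, l)\<in>w. \<not> (i < k \<and> k < j \<and> j < l))"

text \<open>
  Splitting the condition that each vertex lies on exactly one arc into injectivity of the two
  projections, and disjointness and covering for their images, makes it checkable by
  computing the two endpoint sets.
\<close>

lemma webs_iff:
  "w \<in> webs n \<longleftrightarrow>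
     inj_on fst w \<and> inj_on snd w \<and> fst ` w \<inter> snd ` w = {} \<and> fst ` w \<union> snd ` w = {1..2*n} \<and>
     (\<forall>(i, j)\<in>w. i < j) \<and> noncrossing w"
    (is "_ \<longleftrightarrow> ?R")
proof
  assume w: "w \<in> webs n"
  have bounds: "1 \<le> i" "i < j" "j \<le> 2*n" if "(i, j) \<in> w" for i j
    using w that by (auto simp: webs_def)
  have cover: "\<exists>!e. e \<in> w \<and> (v = fst e \<or> v = snd e)" if "v \<in> {1..2*n}" for v
    using w that by (simp add: webs_def)
  have uniq: "e = e'"
    if "e \<in> w" "e' \<in> w" "v = fst e \<or> v = snd e" "v = fst e' \<or> v = snd e'" for e e' v
  proof -
    have "v \<in> {1..2*n}"
      using bounds[of "fst e" "snd e"] that by auto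
    from cover[OF this] that show ?thesis by blast
  qed
  have "inj_on fst w" "inj_on snd w"
    unfolding inj_on_def using uniq by blast+
  moreover have "fst ` w \<inter> snd ` w = {}"
  proof -
    have False if "e \<in> w" "e' \<in> w" "fst e = snd e'" for e e'
    proof -
      have "e = e'" using uniq[of e e' "fst e"] that by simp
      then show False using bounds[of "fst e" "snd e"] that by simp
    qed
    then show ?thesis by blast
  qed
  moreover have "fst ` w \<union> snd ` w = {1..2*n}"
  proof
    show "fst ` w \<union> snd ` w \<subseteq> {1..2*n}"
      using bounds by fastforce
    show "{1..2*n} \<subseteq> fst ` w \<union> snd ` w"
      using cover by blast
  qed
  moreover have "noncrossing w"
    using w by (auto simp: webs_def noncrossing_def)
  ultimately show ?R using bounds by blast
next
  assume R: ?R
  then have inj: "inj_on fst w" "inj_on snd w" and disj: "fst ` w \<inter> snd ` w = {}"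
    and cov: "fst ` w \<union> snd ` w = {1..2*n}" and lt: "\<And>i j. (i, j) \<in> w \<Longrightarrow> i < j"
    by auto
  have "\<exists>!e. e \<in> w \<and> (v = fst e \<or> v = snd e)" if v: "v \<in> {1..2*n}" for v
  proof -
    obtain e where e: "e \<in> w" "v = fst e \<or> v = snd e"
      using v cov by blast
    have "e' = e" if "e' \<in> w" "v = fst e' \<or> v = snd e'" for e'
      using that e disj inj by (metis IntI empty_iff image_eqI inj_onD)
    then show ?thesis using e by blast
  qed
  moreover have "1 \<le> i \<and> i < j \<and> j \<le> 2*n" if "(i, j) \<in> w" for i j
  proof -
    have "i \<in> {1..2*n}" "j \<in> {1..2*n}"
      using that cov by (force)+
    then show ?thesis using lt that by auto
  qed
  ultimately show "w \<in> webs n"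
    using R by (fastforce simp: webs_def noncrossing_def case_prod_beta)
qed

lemma webs_fst_unique: "w \<in> webs n \<Longrightarrow> (i, j) \<in> w \<Longrightarrow> (i, k) \<in> w \<Longrightarrow> j = k"
  using inj_onD[of fst w "(i, j)" "(i, k)"] by (simp add: webs_iff)

lemma webs_snd_unique: "w \<in> webs n \<Longrightarrow> (i, k) \<in> w \<Longrightarrow> (j, k) \<in> w \<Longrightarrow> i = j"
  using inj_onD[of snd w "(i, k)" "(j, k)"] by (simp add: webs_iff)

lemma webs_fst_snd_disjoint: "w \<in> webs n \<Longrightarrow> (i, j) \<in> w \<Longrightarrow> (k, i) \<in> w \<Longrightarrow> False"
  unfolding webs_iff by (metis IntI empty_iff fst_conv image_eqI snd_conv)

lemma webs_less: "w \<in> webs n \<Longrightarrow> (i, j) \<in> w \<Longrightarrow> i < j"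
  by (auto simp: webs_iff)

lemma webs_noncrossing:
  "w \<in> webs n \<Longrightarrow> (i, j) \<in> w \<Longrightarrow> (k, l) \<in> w \<Longrightarrow> i < k \<Longrightarrow> k < j \<Longrightarrow> l \<le> j"
  by (force simp: webs_iff noncrossing_def)

lemma webs_fst_eq: "w \<in> webs n \<Longrightarrow> fst ` w = {1..2*n} - snd ` w"
  by (auto simp: webs_iff)

lemma webs_finite:
  assumes "w \<in> webs n"
  shows "finite w"
proof -
  have "fst ` w \<subseteq> {1..2*n}" "inj_on fst w"
    using assms by (auto simp: webs_iff)
  then show ?thesis by (meson finite_atLeastAtMost finite_imageD finite_subset)
qed

lemma webs_card:
  assumes "w \<in> webs n"
  shows "card (fst ` w) = n" "card (snd ` w) = n"
proof -
  have "card (fst ` w) = card w" "card (snd ` w) = card w"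
    using assms by (auto simp: webs_iff card_image)
  moreover have "card (fst ` w \<union> snd ` w) = card (fst ` w) + card (snd ` w)"
    using assms webs_finite[OF assms] by (intro card_Un_disjoint) (auto simp: webs_iff)
  moreover have "card (fst ` w \<union> snd ` w) = 2*n"
    using assms by (simp add: webs_iff)
  ultimately show "card (fst ` w) = n" "card (snd ` w) = n" by linarith+
qed

text \<open>
  Suppose the arcs ending before \<open>b\<close> agree, but \<open>b\<close> is joined to \<open>a\<close> in one web and to
  a larger \<open>a'\<close> in the other. Then \<open>a'\<close> lies under the arc \<open>(a, b)\<close> of the first web and is a left
  endpoint there, so the arc it starts must end before \<open>b\<close>; but that arc is shared with the second
  web, which joins \<open>a'\<close> to \<open>b\<close>.
\<close>

lemma web_eqI:
  assumes w: "w \<in> webs n" and w': "w' \<in> webs n" and eq: "snd ` w = snd ` w'"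
  shows "w = w'"
proof -
  have no_longer: False
    if v: "v \<in> webs n" "v' \<in> webs n" "snd ` v = snd ` v'"
      and IH: "\<And>c i. c < b \<Longrightarrow> (i, c) \<in> v \<longleftrightarrow> (i, c) \<in> v'"
      and ab: "(a, b) \<in> v" "(a', b) \<in> v'" "a < a'" for v v' a a' b
  proof -
    have "fst ` v = fst ` v'"
      using webs_fst_eq[OF v(1)] webs_fst_eq[OF v(2)] v(3) by simp
    moreover have "a' \<in> fst ` v'" using ab(2) by force
    ultimately have "a' \<in> fst ` v" by simp
    then obtain c where c: "(a', c) \<in> v" by force
    have "c \<le> b"
      using webs_noncrossing[OF v(1) ab(1) c ab(3)] webs_less[OF v(2) ab(2)] by simp
    moreover have "c \<noteq> b"
      using webs_snd_unique[OF v(1) ab(1), of a'] c ab(3) by auto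
    ultimately have "(a', c) \<in> v'" "c \<noteq> b" using IH c by auto
    then show False using webs_fst_unique[OF v(2) ab(2), of c] by auto
  qed
  have "(i, b) \<in> w \<longleftrightarrow> (i, b) \<in> w'" for i b
  proof (induction b arbitrary: i rule: less_induct)
    case (less b)
    have same: "a = a'" if "(a, b) \<in> w" "(a', b) \<in> w'" for a a'
      using no_longer[OF w w' eq less.IH that]
        no_longer[OF w' w eq[symmetric] less.IH[symmetric] that(2,1)]
      by (meson linorder_neqE_nat)
    show ?case
    proof
      assume i: "(i, b) \<in> w"
      then have "b \<in> snd ` w'" using eq by force
      then obtain a' where "(a', b) \<in> w'" by force
      then show "(i, b) \<in> w'" using same i by blast
    next
      assume i: "(i, b) \<in> w'"
      then have "b \<in> snd ` w" using eq by force
      then obtain a where "(a, b) \<in> w" by force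
      then show "(i, b) \<in> w" using same i by blast
    qed
  qed
  then show ?thesis by auto
qed


section \<open>Tableaux and their second rows\<close>

lemma tableauxD:
  assumes "T \<in> tableaux n"
  shows "length (fst T) = n" "length (snd T) = n"
    "set (fst T) \<inter> set (snd T) = {}" "set (fst T) \<union> set (snd T) = {1..2*n}"
    "sorted_wrt (<) (fst T)" "sorted_wrt (<) (snd T)"
    "\<And>c. c < n \<Longrightarrow> fst T ! c < snd T ! c"
  using assms by (auto simp: tableaux_def)

lemma strict_sorted_nth_less_iff:
  fixes xs :: "nat list"
  assumes "sorted_wrt (<) xs" "c < length xs" "d < length xs"
  shows "xs ! c < xs ! d \<longleftrightarrow> c < d"
  using assms by (metis linorder_neqE_nat order_less_asym sorted_wrt_nth_less)

lemma tableau_eqI: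
  assumes "T \<in> tableaux n" "T' \<in> tableaux n" "set (snd T) = set (snd T')"
  shows "T = T'"
proof (rule prod_eqI)
  have "set (fst T) = {1..2*n} - set (snd T)" "set (fst T') = {1..2*n} - set (snd T')"
    using tableauxD(3,4)[OF assms(1)] tableauxD(3,4)[OF assms(2)] by auto
  then show "fst T = fst T'"
    using assms(3) tableauxD(5)[OF assms(1)] tableauxD(5)[OF assms(2)]
    by (simp add: strict_sorted_equal)
  show "snd T = snd T'"
    using assms(3) tableauxD(6)[OF assms(1)] tableauxD(6)[OF assms(2)]
    by (simp add: strict_sorted_equal)
qed

text \<open>
  The column condition holds for a web because the first \<open>c+1\<close> right endpoints are joined to
  \<open>c+1\<close> distinct left endpoints, all smaller than the \<open>c\<close>-th right endpoint (counting from 0), whereas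
  only \<open>c\<close> left endpoints are smaller than the \<open>c\<close>-th left endpoint.
\<close>

lemma web_tableau:
  assumes w: "w \<in> webs n"
  obtains T where "T \<in> tableaux n" "set (fst T) = fst ` w" "set (snd T) = snd ` w"
proof -
  define ls where "ls = sorted_list_of_set (fst ` w)"
  define rs where "rs = sorted_list_of_set (snd ` w)"
  have fin: "finite (fst ` w)" "finite (snd ` w)"
    using webs_finite[OF w] by auto
  have set: "set ls = fst ` w" "set rs = snd ` w"
    using fin by (simp_all add: ls_def rs_def)
  have len: "length ls = n" "length rs = n"
    using webs_card[OF w] by (simp_all add: ls_def rs_def)
  have sorted: "sorted_wrt (<) ls" "sorted_wrt (<) rs"
    by (simp_all add: ls_def rs_def)
  have "ls ! c < rs ! c" if c: "c < n" for c
  proof (rule ccontr)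
    assume "\<not> ls ! c < rs ! c"
    then have le: "rs ! c \<le> ls ! c" by simp
    define A where "A = {e \<in> w. snd e \<le> rs ! c}"
    have finA: "finite A" using webs_finite[OF w] by (simp add: A_def)
    have "fst ` A \<subseteq> (!) ls ` {..<c}"
    proof
      fix x assume "x \<in> fst ` A"
      then obtain y where y: "(x, y) \<in> w" "y \<le> rs ! c" by (auto simp: A_def)
      then have "x < ls ! c" using webs_less[OF w] le by fastforce
      moreover have "x \<in> set ls" using y set by force
      then obtain d where "d < n" "x = ls ! d" using len by (metis in_set_conv_nth)
      ultimately show "x \<in> (!) ls ` {..<c}"
        using strict_sorted_nth_less_iff[OF sorted(1)] len c by auto
    qed
    then have "card (fst ` A) \<le> c"
      by (metis card_image_le card_lessThan card_mono finite_imageI finite_lessThan le_trans)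
    moreover have "card (fst ` A) = card A"
      using w by (intro card_image) (auto simp: webs_iff A_def intro: inj_on_subset)
    moreover have "card (snd ` A) \<le> card A"
      using finA by (rule card_image_le)
    moreover have "(!) rs ` {..c} \<subseteq> snd ` A"
    proof
      fix y assume "y \<in> (!) rs ` {..c}"
      then obtain d where d: "d \<le> c" "y = rs ! d" by auto
      then have "y \<in> snd ` w" using set len c by force
      moreover have "y \<le> rs ! c"
        using d sorted(2) len c by (metis le_neq_implies_less less_imp_le order_refl sorted_wrt_nth_less)
      ultimately show "y \<in> snd ` A" by (auto simp: A_def image_iff)
    qed
    then have "card ((!) rs ` {..c}) \<le> card (snd ` A)"
      using finA by (intro card_mono) auto
    moreover have "card ((!) rs ` {..c}) = Suc c"
      using sorted(2) len c
      by (subst card_image) (auto intro!: inj_on_nth simp: strict_sorted_iff)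
    ultimately show False by linarith
  qed
  then have "(ls, rs) \<in> tableaux n"
    using w set len sorted by (auto simp: tableaux_def webs_iff strict_sorted_iff)
  then show thesis using that set by simp
qed

text \<open>
  The two entries cannot share a column, since \<open>i\<close> is below \<open>i+1\<close>. Hence the entry below
  \<open>i+1\<close> exceeds it, the entry above \<open>i\<close> is smaller than \<open>i\<close>, and both columns survive the swap; rows
  stay sorted because no entry lies strictly between \<open>i\<close> and \<open>i+1\<close>.
\<close>

lemma swap_entries_tableau:
  assumes T: "T \<in> tableaux n" and i: "i \<in> set (snd T)" "i + 1 \<in> set (fst T)"
  shows "swap_entries i T \<in> tableaux n"
    "set (snd (swap_entries i T)) = insert (i + 1) (set (snd T) - {i})"
proof -
  note D = tableauxD[OF T]
  let ?s = "Transposition.transpose i (i + 1)"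
  have out: "i \<notin> set (fst T)" "i + 1 \<notin> set (snd T)" using D(3) i by auto
  have s1: "?s x = (if x = i + 1 then i else x)" if "x \<in> set (fst T)" for x
    using that out by (auto simp: Transposition.transpose_def)
  have s2: "?s x = (if x = i then i + 1 else x)" if "x \<in> set (snd T)" for x
    using that out by (auto simp: Transposition.transpose_def)
  have im1: "?s ` set (fst T) = insert i (set (fst T) - {i + 1})"
    using i out s1 by (auto simp: image_iff)
  have im2: "?s ` set (snd T) = insert (i + 1) (set (snd T) - {i})"
    using i out s2 by (auto simp: image_iff)
  show "set (snd (swap_entries i T)) = insert (i + 1) (set (snd T) - {i})"
    using im2 by (simp add: swap_entries_def)
  have sorted1: "sorted_wrt (<) (map ?s (fst T))"
    unfolding sorted_wrt_map
  proof (rule sorted_wrt_mono_rel[OF _ D(5)])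
    fix x y assume xy: "x \<in> set (fst T)" "y \<in> set (fst T)" "x < y"
    then have "x \<noteq> i" using out by auto
    then show "?s x < ?s y" using xy s1[OF xy(1)] s1[OF xy(2)] by auto
  qed
  have sorted2: "sorted_wrt (<) (map ?s (snd T))"
    unfolding sorted_wrt_map
  proof (rule sorted_wrt_mono_rel[OF _ D(6)])
    fix x y assume xy: "x \<in> set (snd T)" "y \<in> set (snd T)" "x < y"
    then have "y \<noteq> i + 1" using out by auto
    then show "?s x < ?s y" using xy s2[OF xy(1)] s2[OF xy(2)] by auto
  qed
  have cols: "?s (fst T ! c) < ?s (snd T ! c)" if c: "c < n" for c
  proof -
    have "fst T ! c \<in> set (fst T)" "snd T ! c \<in> set (snd T)" using c D(1,2) by auto
    then show ?thesis using D(7)[OF c] s1 s2 by fastforce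
  qed
  have bounds: "set (map ?s (fst T)) \<union> set (map ?s (snd T)) = {1..2*n}"
    "set (map ?s (fst T)) \<inter> set (map ?s (snd T)) = {}"
    using D(3,4) i unfolding set_map im1 im2 by auto
  show "swap_entries i T \<in> tableaux n"
    using bounds sorted1 sorted2 cols D(1,2)
    unfolding tableaux_def swap_entries_def strict_sorted_iff by auto
qed


section \<open>The matching procedure\<close>

text \<open>
  The state after processing \<open>B\<close>, with left endpoints drawn from \<open>A\<close>. That
  every vertex below an arc is matched is what keeps later arcs from crossing
  earlier ones: a new arc starts at an unmatched vertex, hence not below an old arc.
\<close>

definition partial_web :: "nat set \<Rightarrow> nat set \<Rightarrow> web \<Rightarrow> bool" where
  "partial_web A B w \<longleftrightarrow>
     inj_on fst w \<and> inj_on snd w \<and> fst ` w \<subseteq> A \<and> snd ` w = B \<and>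
     (\<forall>(i, j)\<in>w. i < j \<and> {i<..<j} \<subseteq> fst ` w \<union> snd ` w) \<and> noncrossing w"

lemma partial_web_match_left:
  assumes pw: "partial_web A B w"
    and B: "\<forall>b'\<in>B. b' < b" "b \<notin> A" "A \<inter> B = {}"
    and below: "{1..<b} \<subseteq> A \<union> B" "0 \<notin> A"
    and fin: "finite B"
    and room: "card B < card {a \<in> A. a < b}"
  shows "partial_web A (insert b B) (match_left b w)"
proof -
  from pw have inj: "inj_on fst w" "inj_on snd w" and sub: "fst ` w \<subseteq> A" and snd: "snd ` w = B"
    and arc: "\<And>i j. (i, j) \<in> w \<Longrightarrow> i < j \<and> {i<..<j} \<subseteq> fst ` w \<union> snd ` w"
    and nc: "noncrossing w"
    by (auto simp: partial_web_def)
  (* The set whose maximum match_left takes; it is nonempty because fewer than card {a \<in> A. a < b}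
     vertices have been used as left endpoints. *)
  define U where "U = {a. 1 \<le> a \<and> a < b \<and> a \<notin> fst ` w \<union> snd ` w}"
  have finw: "finite w" using finite_imageD[of snd w] inj snd fin by simp
  have "card (fst ` w) = card B" using card_image[OF inj(1)] card_image[OF inj(2)] snd by simp
  then have "\<not> {a \<in> A. a < b} \<subseteq> fst ` w"
    using room card_mono[OF finite_imageI[OF finw, of fst]] by (auto simp: not_le[symmetric])
  then obtain x where x: "x \<in> A" "x < b" "x \<notin> fst ` w" by blast
  then have "x \<in> U" using B(3) snd below(2) by (cases x) (auto simp: U_def)
  moreover have finU: "finite U" by (rule finite_subset[of _ "{..<b}"]) (auto simp: U_def)
  ultimately have "Max U \<in> U" by (intro Max_in) auto
  define a where "a = Max U"
  have a: "1 \<le> a" "a < b" "a \<notin> fst ` w" "a \<notin> snd ` w"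
    using \<open>Max U \<in> U\<close> by (auto simp: a_def U_def)
  have aA: "a \<in> A" using a below(1) snd by force
  have new: "match_left b w = insert (a, b) w" by (simp add: match_left_def a_def U_def)
  have bB: "b \<notin> B" using B(1) by auto
  have gap: "{a<..<b} \<subseteq> fst ` w \<union> snd ` w"
  proof
    fix v assume v: "v \<in> {a<..<b}"
    show "v \<in> fst ` w \<union> snd ` w"
    proof (rule ccontr)
      assume "v \<notin> fst ` w \<union> snd ` w"
      then have "v \<in> U" using v by (auto simp: U_def)
      then show False using v Max_ge[OF finU] by (fastforce simp: a_def)
    qed
  qed
  have old: "j < b" "\<not> (i < a \<and> a < j)" if "(i, j) \<in> w" for i j
  proof -
    have "j \<in> B" using snd that by force
    then show "j < b" using B(1) by simp
    show "\<not> (i < a \<and> a < j)" using arc[OF that] a(3,4) by auto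
  qed
  have "\<not> (i < k \<and> k < j \<and> j < l)"
    if "(i, j) \<in> insert (a, b) w" "(k, l) \<in> insert (a, b) w" for i j k l
  proof -
    have "\<not> (i < k \<and> k < j \<and> j < l)" if "(i, j) \<in> w" "(k, l) \<in> w"
      using nc that unfolding noncrossing_def by fast
    then show ?thesis using that old(1)[of k l] old(2)[of i j] by auto
  qed
  then have "noncrossing (insert (a, b) w)"
    unfolding noncrossing_def by blast
  moreover have "i < j \<and> {i<..<j} \<subseteq> fst ` insert (a, b) w \<union> snd ` insert (a, b) w"
    if "(i, j) \<in> insert (a, b) w" for i j
    using that gap a(2) arc[of i j] by (cases "(i, j) = (a, b)") auto
  moreover have "inj_on fst (insert (a, b) w)" "inj_on snd (insert (a, b) w)"
    using inj a(3) bB snd by auto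
  ultimately show ?thesis
    unfolding partial_web_def new using sub snd aA by auto
qed

text \<open>
  The column condition supplies the left endpoint at each step: before the entry in column
  \<open>m\<close> (counting from 0) is processed, \<open>m\<close> vertices are used as left endpoints, and the first-row
  entries of columns \<open>0\<close> to \<open>m\<close> are \<open>m+1\<close> candidates to its left.
\<close>

lemma partial_web_psi_prefix:
  assumes T: "T \<in> tableaux n" and "m \<le> n"
  shows "partial_web (set (fst T)) (set (take m (snd T))) (fold match_left (take m (snd T)) {})"
  using \<open>m \<le> n\<close>
proof (induction m)
  case 0
  show ?case by (simp add: partial_web_def noncrossing_def)
next
  case (Suc m)
  note D = tableauxD[OF T]
  let ?b = "snd T ! m"
  have m: "m < n" using Suc.prems by simp
  have prefix: "set (take m (snd T)) = (!) (snd T) ` {..<m}"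
    using m D(2) by (simp add: nth_image[symmetric] atLeast0LessThan)
  have snoc: "take (Suc m) (snd T) = take m (snd T) @ [?b]"
    using m D(2) by (simp add: take_Suc_conv_app_nth)
  have bT: "?b \<in> set (snd T)" using m D(2) by simp
  have small: "x \<in> set (take m (snd T))" if x: "x \<in> set (snd T)" "x < ?b" for x
  proof -
    obtain d where "d < n" "x = snd T ! d"
      using x(1) D(2) by (metis in_set_conv_nth)
    then show ?thesis
      using x(2) strict_sorted_nth_less_iff[OF D(6)] D(2) m unfolding prefix by auto
  qed
  have "partial_web (set (fst T)) (insert ?b (set (take m (snd T))))
          (match_left ?b (fold match_left (take m (snd T)) {}))"
  proof (rule partial_web_match_left)
    show "partial_web (set (fst T)) (set (take m (snd T))) (fold match_left (take m (snd T)) {})"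
      using Suc by simp
    show "\<forall>b'\<in>set (take m (snd T)). b' < ?b"
      using strict_sorted_nth_less_iff[OF D(6)] D(2) m unfolding prefix by auto
    show "?b \<notin> set (fst T)" using bT D(3) by auto
    show "set (fst T) \<inter> set (take m (snd T)) = {}"
      using D(3) set_take_subset[of m "snd T"] by auto
    show "{1..<?b} \<subseteq> set (fst T) \<union> set (take m (snd T))"
    proof
      fix x assume x: "x \<in> {1..<?b}"
      have "?b \<le> 2*n" using bT D(4) by (metis UnCI atLeastAtMost_iff)
      then have "x \<in> set (fst T) \<union> set (snd T)" using x D(4) by simp
      then show "x \<in> set (fst T) \<union> set (take m (snd T))" using small x by auto
    qed
    show "0 \<notin> set (fst T)" using D(4) by (metis UnCI atLeastAtMost_iff not_one_le_zero)
    show "finite (set (take m (snd T)))" by simp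
    have "(!) (fst T) ` {..m} \<subseteq> {a \<in> set (fst T). a < ?b}"
    proof
      fix x assume "x \<in> (!) (fst T) ` {..m}"
      then obtain d where d: "d \<le> m" "x = fst T ! d" by auto
      then have "x \<le> fst T ! m"
        using D(1,5) m by (metis le_neq_implies_less less_imp_le order_refl sorted_wrt_nth_less)
      then show "x \<in> {a \<in> set (fst T). a < ?b}"
        using d D(1) D(7)[OF m] m by auto
    qed
    then have "card ((!) (fst T) ` {..m}) \<le> card {a \<in> set (fst T). a < ?b}"
      by (intro card_mono) auto
    moreover have "card ((!) (fst T) ` {..m}) = Suc m"
      using D(1,5) m by (subst card_image) (auto intro!: inj_on_nth simp: strict_sorted_iff)
    moreover have "card (set (take m (snd T))) \<le> m"
      using card_length[of "take m (snd T)"] by simp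
    ultimately show "card (set (take m (snd T))) < card {a \<in> set (fst T). a < ?b}" by linarith
  qed
  then show ?case by (simp add: snoc)
qed

lemma psi_web:
  assumes T: "T \<in> tableaux n"
  shows "psi T \<in> webs n" "fst ` psi T = set (fst T)" "snd ` psi T = set (snd T)"
proof -
  note D = tableauxD[OF T]
  have "partial_web (set (fst T)) (set (snd T)) (psi T)"
    using partial_web_psi_prefix[OF T order_refl] D(2) by (simp add: psi_def)
  then have pw: "inj_on fst (psi T)" "inj_on snd (psi T)" "fst ` psi T \<subseteq> set (fst T)"
    "snd ` psi T = set (snd T)" "\<forall>(i, j)\<in>psi T. i < j" "noncrossing (psi T)"
    by (auto simp: partial_web_def)
  have "card (fst ` psi T) = card (snd ` psi T)"
    using pw(1,2) by (simp add: card_image)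
  also have "\<dots> = card (set (fst T))"
    using D(1,2,5,6) pw(4) by (simp add: strict_sorted_iff distinct_card)
  finally show eq: "fst ` psi T = set (fst T)"
    using pw(3) by (intro card_subset_eq) auto
  show "snd ` psi T = set (snd T)" by (rule pw(4))
  show "psi T \<in> webs n" using pw eq D(3,4) by (simp add: webs_iff)
qed

lemma bij_betw_psi: "bij_betw psi (tableaux n) (webs n)"
proof (rule bij_betw_imageI)
  show "inj_on psi (tableaux n)"
    by (rule inj_onI) (metis psi_web(3) tableau_eqI)
  have "w \<in> psi ` tableaux n" if w: "w \<in> webs n" for w
  proof -
    obtain T where T: "T \<in> tableaux n" "set (snd T) = snd ` w"
      using web_tableau[OF w] by metis
    then have "psi T = w" using psi_web[OF T(1)] w by (intro web_eqI) auto
    then show ?thesis using T(1) by blast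
  qed
  then show "psi ` tableaux n = webs n" using psi_web(1) by blast
qed


section \<open>Edges\<close>

lemma partner_eq:
  assumes w: "w \<in> webs n"
  shows "(i, j) \<in> w \<Longrightarrow> partner w i = j" "(j, i) \<in> w \<Longrightarrow> partner w i = j"
proof -
  have *: "k = j" if "mk_arc i j \<in> w" "mk_arc i k \<in> w" for k
    using that webs_fst_unique[OF w, of i] webs_snd_unique[OF w, of _ i]
      webs_fst_snd_disjoint[OF w, of i]
    by (auto simp: mk_arc_def min_def max_def split: if_splits)
  show "partner w i = j" if "(i, j) \<in> w"
  proof -
    have "mk_arc i j \<in> w" using that webs_less[OF w that] by (simp add: mk_arc_def)
    then show ?thesis unfolding partner_def using * by (intro the_equality)
  qed
  show "partner w i = j" if "(j, i) \<in> w"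
  proof -
    have "mk_arc i j \<in> w" using that webs_less[OF w that] by (simp add: mk_arc_def)
    then show ?thesis unfolding partner_def using * by (intro the_equality)
  qed
qed

lemma reconnect_unnested:
  assumes w: "w \<in> webs n" and arcs: "(j, i) \<in> w" "(i + 1, k) \<in> w"
  shows "reconnect i w = (w - {(j, i), (i + 1, k)}) \<union> {(i, i + 1), (j, k)}"
  using webs_less[OF w arcs(1)] webs_less[OF w arcs(2)] partner_eq(2)[OF w arcs(1)]
    partner_eq(1)[OF w arcs(2)]
  by (simp add: reconnect_def mk_arc_def)

text \<open>
  No other arc has an endpoint at \<open>i\<close> or \<open>i+1\<close>, so an arc crossing the new \<open>(j, k)\<close> would already
  cross \<open>(j, i)\<close> or \<open>(i+1, k)\<close>.
\<close>

lemma reconnect_web: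
  assumes w: "w \<in> webs n" and arcs: "(j, i) \<in> w" "(i + 1, k) \<in> w"
  shows "reconnect i w \<in> webs n" "snd ` reconnect i w = insert (i + 1) (snd ` w - {i})"
proof -
  define v where "v = w - {(j, i), (i + 1, k)}"
  have r: "reconnect i w = insert (i, i + 1) (insert (j, k) v)"
    using reconnect_unnested[OF w arcs] by (auto simp: v_def)
  have lt: "j < i" "i + 1 < k" using webs_less[OF w] arcs by auto
  have inj: "inj_on fst w" "inj_on snd w" using w by (auto simp: webs_iff)
  have wv: "w = insert (j, i) (insert (i + 1, k) v)"
    using arcs by (auto simp: v_def)
  have injv: "inj_on fst v" "inj_on snd v"
    using inj by (auto simp: v_def intro: inj_on_subset)
  have off: "x \<noteq> j" "x \<noteq> i" "x \<noteq> i + 1" "x \<noteq> k" "y \<noteq> j" "y \<noteq> i" "y \<noteq> i + 1" "y \<noteq> k"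
    if xy: "(x, y) \<in> v" for x y
  proof -
    have "(x, y) \<in> w" "(x, y) \<noteq> (j, i)" "(x, y) \<noteq> (i + 1, k)" using xy by (auto simp: v_def)
    then show "x \<noteq> j" "x \<noteq> i" "x \<noteq> i + 1" "x \<noteq> k" "y \<noteq> j" "y \<noteq> i" "y \<noteq> i + 1" "y \<noteq> k"
      using arcs webs_fst_unique[OF w] webs_snd_unique[OF w] webs_fst_snd_disjoint[OF w]
      by blast+
  qed
  have offs: "{j, i, i + 1, k} \<inter> (fst ` v \<union> snd ` v) = {}" using off by fastforce
  have ends_w: "fst ` w = {j, i + 1} \<union> fst ` v" "snd ` w = {i, k} \<union> snd ` v"
    unfolding wv by simp_all
  have fst_r: "fst ` reconnect i w = insert i (fst ` w - {i + 1})"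
    and snd_r: "snd ` reconnect i w = insert (i + 1) (snd ` w - {i})"
    using offs lt unfolding r ends_w by (simp_all add: insert_Diff_if)
  show "snd ` reconnect i w = insert (i + 1) (snd ` w - {i})" by (fact snd_r)
  have ends: "i \<in> snd ` w" "i + 1 \<in> fst ` w" using arcs by force+
  have "noncrossing (reconnect i w)"
  proof -
    have nc: "l \<le> y" if "(x, y) \<in> w" "(z, l) \<in> w" "x < z" "z < y" for x y z l
      using webs_noncrossing[OF w] that by blast
    have vw: "(x, y) \<in> w" if "(x, y) \<in> v" for x y using that by (simp add: v_def)
    have "\<not> (x < i \<and> i < y \<and> y < i + 1)" "\<not> (i < x \<and> x < i + 1 \<and> i + 1 < y)" for x y by auto
    moreover have "\<not> (x < j \<and> j < y \<and> y < k)" if xy: "(x, y) \<in> v" for x y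
      using nc[OF vw[OF xy] arcs(1)] nc[OF vw[OF xy] arcs(2)] off[OF xy] lt by linarith
    moreover have "\<not> (j < x \<and> x < k \<and> k < y)" if xy: "(x, y) \<in> v" for x y
      using nc[OF arcs(1) vw[OF xy]] nc[OF arcs(2) vw[OF xy]] off[OF xy] lt by linarith
    moreover have "\<not> (x < z \<and> z < y \<and> y < l)" if "(x, y) \<in> v" "(z, l) \<in> v" for x y z l
      using nc[OF vw vw] that by fastforce
    ultimately show ?thesis
      unfolding noncrossing_def r using lt by fastforce
  qed
  moreover have "inj_on fst (reconnect i w)" "inj_on snd (reconnect i w)"
    using injv offs lt unfolding r by auto
  moreover have "\<forall>(x, y)\<in>reconnect i w. x < y"
    using lt webs_less[OF w] by (auto simp: r v_def)
  moreover have "fst ` reconnect i w \<inter> snd ` reconnect i w = {}"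
    "fst ` reconnect i w \<union> snd ` reconnect i w = {1..2*n}"
    using w ends unfolding fst_r snd_r webs_iff by auto
  ultimately show "reconnect i w \<in> webs n"
    unfolding webs_iff by blast
qed

text \<open>
  Both sides are webs whose right endpoints are those of \<open>psi T\<close> with \<open>i\<close> replaced by \<open>i+1\<close>, so
  \<open>web_eqI\<close> identifies them.
\<close>

lemma psi_swap_entries:
  assumes T: "T \<in> tableaux n" and i: "i \<in> set (snd T)" "i + 1 \<in> set (fst T)"
  shows "psi (swap_entries i T) = reconnect i (psi T)"
proof -
  obtain j k where arcs: "(j, i) \<in> psi T" "(i + 1, k) \<in> psi T"
    using i psi_web(2,3)[OF T] by force
  note swap = swap_entries_tableau[OF T i]
  note rec = reconnect_web[OF psi_web(1)[OF T] arcs]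
  show ?thesis
    using psi_web[OF swap(1)] psi_web(3)[OF T] swap(2) rec by (intro web_eqI) auto
qed

lemma web_basis_inject: "web_basis w = web_basis w' \<longleftrightarrow> w = w'"
  by (auto simp: web_basis_def dest!: arg_cong[of _ _ Poly_Mapping.keys])

text \<open>
  The linear-algebraic condition on \<open>w'\<close> reduces to an equation between webs: since \<open>i\<close> is a right
  endpoint, \<open>(i, i+1)\<close> is not an arc, and basis vectors of distinct webs are distinct. Any arcs
  \<open>(j, i)\<close> and \<open>(i+1, k)\<close> are automatically unnested, so their existence only constrains on which
  side of their arcs \<open>i\<close> and \<open>i+1\<close> lie.
\<close>

lemma web_graph_edge_iff:
  assumes w: "w \<in> webs n"
  shows "(w, i, w') \<in> arcs (web_graph n) \<longleftrightarrow>
    i \<in> snd ` w \<and> i + 1 \<in> fst ` w \<and> w' = reconnect i w"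
proof
  assume "(w, i, w') \<in> arcs (web_graph n)"
  then obtain j k where arcs: "(j, i) \<in> w" "(i + 1, k) \<in> w"
    and act: "act_basis i w = web_basis w + web_basis w'"
    by (auto simp: web_graph_def web_act_basis)
  have "(i, i + 1) \<notin> w" using arcs webs_fst_snd_disjoint[OF w] by blast
  then have "w' = reconnect i w" using act by (simp add: act_basis_def web_basis_inject)
  then show "i \<in> snd ` w \<and> i + 1 \<in> fst ` w \<and> w' = reconnect i w" using arcs by force
next
  assume R: "i \<in> snd ` w \<and> i + 1 \<in> fst ` w \<and> w' = reconnect i w"
  then obtain j k where arcs: "(j, i) \<in> w" "(i + 1, k) \<in> w" by force
  have "(i, i + 1) \<notin> w" using arcs webs_fst_snd_disjoint[OF w] by blast
  then have "web_act i (web_basis w) = web_basis w + web_basis w'"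
    using R by (simp add: web_act_basis act_basis_def)
  moreover have "i \<in> {1..2*n}" "i + 1 \<in> {1..2*n}" using w R unfolding webs_iff by blast+
  then have "i \<in> {1..2*n-1}" by auto
  ultimately show "(w, i, w') \<in> arcs (web_graph n)"
    using w R arcs reconnect_web(1)[OF w arcs] by (auto simp: web_graph_def)
qed

lemma tableau_graph_edge_iff:
  assumes T: "T \<in> tableaux n"
  shows "(T, i, T') \<in> arcs (tableau_graph n) \<longleftrightarrow>
    i \<in> set (snd T) \<and> i + 1 \<in> set (fst T) \<and> T' = swap_entries i T"
proof -
  have "i \<in> {1..2*n-1}" if "i \<in> set (snd T)" "i + 1 \<in> set (fst T)"
  proof -
    have "i \<in> {1..2*n}" "i + 1 \<in> {1..2*n}" using that tableauxD(4)[OF T] by blast+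
    then show ?thesis by auto
  qed
  then show ?thesis
    using T swap_entries_tableau(1)[OF T] by (auto simp: tableau_graph_def)
qed

lemma psi_arcs:
  "(\<lambda>(T, i, T'). (psi T, i, psi T')) ` arcs (tableau_graph n) = arcs (web_graph n)"
    (is "?f ` _ = _")
proof
  have T_edge: "(psi T, i, psi T') \<in> arcs (web_graph n)"
    if "(T, i, T') \<in> arcs (tableau_graph n)" for T i T'
  proof -
    have T: "T \<in> tableaux n" using that by (simp add: tableau_graph_def)
    then show ?thesis
      using that psi_web[OF T]
      by (simp add: web_graph_edge_iff tableau_graph_edge_iff psi_swap_entries)
  qed
  then show "?f ` arcs (tableau_graph n) \<subseteq> arcs (web_graph n)" by auto
  show "arcs (web_graph n) \<subseteq> ?f ` arcs (tableau_graph n)"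
  proof (clarify)
    fix w i w' assume e: "(w, i, w') \<in> arcs (web_graph n)"
    then have "w \<in> webs n" by (simp add: web_graph_def)
    then obtain T where T: "T \<in> tableaux n" "w = psi T"
      using bij_betw_imp_surj_on[OF bij_betw_psi[of n]] by blast
    then have "(T, i, swap_entries i T) \<in> arcs (tableau_graph n)"
      and "w' = psi (swap_entries i T)"
      using e psi_web[OF T(1)]
      by (simp_all add: web_graph_edge_iff tableau_graph_edge_iff psi_swap_entries)
    then show "(w, i, w') \<in> ?f ` arcs (tableau_graph n)"
      using T(2) by (force simp: image_iff)
  qed
qed

theorem theorem2p2:
  fixes n :: nat
  assumes "n \<ge> 1"
  shows "bij_betw psi (tableaux n) (webs n)
    \<and> pre_digraph.digraph_isomorphism (tableau_graph n) psi_iso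
    \<and> app_iso psi_iso (tableau_graph n) = web_graph n
    \<and> digraph_iso (tableau_graph n) (web_graph n)"
proof -
  have inj: "inj_on psi (tableaux n)" and im: "psi ` tableaux n = webs n"
    using bij_betw_psi by (auto simp: bij_betw_def)
  have "wf_digraph (tableau_graph n)"
    by unfold_locales (auto simp: tableau_graph_def)
  moreover have "inj_on (\<lambda>(T, i, T'). (psi T, i, psi T')) (arcs (tableau_graph n))"
    using inj by (auto simp: inj_on_def tableau_graph_def)
  ultimately have iso: "pre_digraph.digraph_isomorphism (tableau_graph n) psi_iso"
    unfolding pre_digraph.digraph_isomorphism_def
    using inj by (auto simp: psi_iso_def tableau_graph_def)
  have "app_iso psi_iso (tableau_graph n) = web_graph n"
  proof (rule pre_digraph.equality)
    show "verts (app_iso psi_iso (tableau_graph n)) = verts (web_graph n)"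
      using im by (simp add: psi_iso_def tableau_graph_def web_graph_def)
    show "arcs (app_iso psi_iso (tableau_graph n)) = arcs (web_graph n)"
      using psi_arcs by (simp add: psi_iso_def)
  qed (simp_all add: psi_iso_def web_graph_def)
  then show ?thesis
    using bij_betw_psi iso unfolding digraph_iso_def by metis
qed

end
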